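(* The topological vector space $\mathcal{S}(\mathbb{R}_+)$ is not normable, i.e., there is no norm on $\mathcal{S}(\mathbb{R}_+)$ which induces its topology.
   Context: $\mathbb{R}_+=(0,\infty)$, $\mathbb{N}_0=\{0,1,2,\ldots\}$. $\mathcal{S}(\mathbb{R}_+)$ is the real vector space of all $f\in C^\infty(\mathbb{R}_+)$ (real-valued) such that for all $\alpha\in\mathbb{Z}$ and $\beta\in\mathbb{N}_0$ one has $p_{\alpha,\beta}(f) := \sup_{x\in\mathbb{R}_+} |x^\alpha f^{(\beta)}(x)| < \infty$. It carries the locally convex topology generated by the countable family of seminorms $(p_{\alpha,\beta})_{\alpha\in\mathbb{Z},\beta\in\mathbb{N}_0}$. *)

theory Defs
  imports "HOL-Analysis.Analysis"
begin

definition smooth_on_Rpos :: "(real \<Rightarrow> real) \<Rightarrow> bool" where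
  "smooth_on_Rpos f \<longleftrightarrow> (\<forall>n. \<forall>x>0. (deriv ^^ n) f field_differentiable at x)"

(* Functions on the open half-line are represented by their extension by 0 to the reals.
   As the half-line is open, the values on it of the iterated derivatives of such an
   extension are the derivatives of the original function. *)
definition schwartz_Rpos_set :: "(real \<Rightarrow> real) set" where
  "schwartz_Rpos_set = {f. (\<forall>x\<le>0. f x = 0) \<and> smooth_on_Rpos f \<and>
     (\<forall>(\<alpha>::int) (\<beta>::nat). bdd_above ((\<lambda>x. \<bar>x powi \<alpha> * (deriv ^^ \<beta>) f x\<bar>) ` {0<..}))}"

lemma higher_deriv_zero_fun: "(deriv ^^ n) (\<lambda>_::real. 0::real) = (\<lambda>_. 0)"
  by (induction n) auto

lemma higher_deriv_lincomb_Rpos: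
  fixes f g :: "real \<Rightarrow> real"
  assumes "smooth_on_Rpos f" "smooth_on_Rpos g" "x > 0"
  shows "(deriv ^^ n) (\<lambda>x. a * f x + b * g x) x = a * (deriv ^^ n) f x + b * (deriv ^^ n) g x"
  using \<open>x > 0\<close>
proof (induction n arbitrary: x)
  case 0
  then show ?case by simp
next
  case (Suc n)
  have "\<forall>\<^sub>F y in nhds x. y \<in> {0<..}"
    using Suc.prems by (intro eventually_nhds_in_open) auto
  then have "\<forall>\<^sub>F y in nhds x. (deriv ^^ n) (\<lambda>x. a * f x + b * g x) y
      = a * (deriv ^^ n) f y + b * (deriv ^^ n) g y"
    by (rule eventually_mono) (use Suc.IH in auto)
  then have "deriv ((deriv ^^ n) (\<lambda>x. a * f x + b * g x)) x
      = deriv (\<lambda>y. a * (deriv ^^ n) f y + b * (deriv ^^ n) g y) x"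
    by (rule deriv_cong_ev) simp
  also have "\<dots> = a * deriv ((deriv ^^ n) f) x + b * deriv ((deriv ^^ n) g) x"
  proof -
    have "(deriv ^^ n) f field_differentiable at x" "(deriv ^^ n) g field_differentiable at x"
      using assms(1,2) Suc.prems by (auto simp: smooth_on_Rpos_def)
    then show ?thesis
      by (intro DERIV_imp_deriv DERIV_add DERIV_cmult)
        (simp_all add: field_differentiable_derivI)
  qed
  finally show ?case by simp
qed

lemma schwartz_Rpos_set_lincomb:
  assumes f: "f \<in> schwartz_Rpos_set" and g: "g \<in> schwartz_Rpos_set"
  shows "(\<lambda>x. a * f x + b * g x) \<in> schwartz_Rpos_set"
proof -
  let ?h = "\<lambda>x. a * f x + b * g x"
  have sf: "smooth_on_Rpos f" and sg: "smooth_on_Rpos g"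
    using f g by (auto simp: schwartz_Rpos_set_def)
  note D = higher_deriv_lincomb_Rpos[OF sf sg]
  have "(deriv ^^ n) ?h field_differentiable at x" if "x > 0" for n x
  proof -
    have "(\<lambda>y. a * (deriv ^^ n) f y + b * (deriv ^^ n) g y) field_differentiable at x"
      using sf sg that by (intro derivative_intros) (auto simp: smooth_on_Rpos_def)
    then obtain d where
      "((\<lambda>y. a * (deriv ^^ n) f y + b * (deriv ^^ n) g y) has_field_derivative d) (at x)"
      by (auto simp: field_differentiable_def)
    then have "((deriv ^^ n) ?h has_field_derivative d) (at x)"
      by (rule has_field_derivative_transform_within_open[where S = "{0<..}"])
        (use that D in auto)
    then show ?thesis
      by (auto simp: field_differentiable_def)
  qed
  moreover have "bdd_above ((\<lambda>x. \<bar>x powi \<alpha> * (deriv ^^ \<beta>) ?h x\<bar>) ` {0<..})" for \<alpha> \<beta>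
  proof -
    obtain A where A: "\<And>x. x > 0 \<Longrightarrow> \<bar>x powi \<alpha> * (deriv ^^ \<beta>) f x\<bar> \<le> A"
      using f by (fastforce simp: schwartz_Rpos_set_def bdd_above_def)
    obtain B where B: "\<And>x. x > 0 \<Longrightarrow> \<bar>x powi \<alpha> * (deriv ^^ \<beta>) g x\<bar> \<le> B"
      using g by (fastforce simp: schwartz_Rpos_set_def bdd_above_def)
    have "\<bar>x powi \<alpha> * (deriv ^^ \<beta>) ?h x\<bar> \<le> \<bar>a\<bar> * A + \<bar>b\<bar> * B" if "x > 0" for x
    proof -
      have "x powi \<alpha> * (deriv ^^ \<beta>) ?h x
          = a * (x powi \<alpha> * (deriv ^^ \<beta>) f x) + b * (x powi \<alpha> * (deriv ^^ \<beta>) g x)"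
        using D[OF that] by (simp add: algebra_simps)
      also have "\<bar>\<dots>\<bar> \<le> \<bar>a\<bar> * \<bar>x powi \<alpha> * (deriv ^^ \<beta>) f x\<bar> + \<bar>b\<bar> * \<bar>x powi \<alpha> * (deriv ^^ \<beta>) g x\<bar>"
        by (metis abs_mult abs_triangle_ineq)
      also have "\<dots> \<le> \<bar>a\<bar> * A + \<bar>b\<bar> * B"
        using A[OF that] B[OF that] by (intro add_mono mult_left_mono) auto
      finally show ?thesis .
    qed
    then show ?thesis
      by (intro bdd_aboveI2) auto
  qed
  ultimately show ?thesis
    using f g by (auto simp: schwartz_Rpos_set_def smooth_on_Rpos_def)
qed

lemma schwartz_Rpos_set_zero: "(\<lambda>_. 0) \<in> schwartz_Rpos_set"
  by (auto simp: schwartz_Rpos_set_def smooth_on_Rpos_def higher_deriv_zero_fun)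

typedef schwartz_Rpos = schwartz_Rpos_set
  morphisms schwartz_fun Abs_schwartz_Rpos
  using schwartz_Rpos_set_zero by blast

setup_lifting type_definition_schwartz_Rpos

instantiation schwartz_Rpos :: real_vector
begin

lift_definition zero_schwartz_Rpos :: schwartz_Rpos is "\<lambda>_. 0"
  by (rule schwartz_Rpos_set_zero)

lift_definition plus_schwartz_Rpos :: "schwartz_Rpos \<Rightarrow> schwartz_Rpos \<Rightarrow> schwartz_Rpos"
  is "\<lambda>f g x. f x + g x"
  using schwartz_Rpos_set_lincomb[where a = 1 and b = 1] by simp

lift_definition minus_schwartz_Rpos :: "schwartz_Rpos \<Rightarrow> schwartz_Rpos \<Rightarrow> schwartz_Rpos"
  is "\<lambda>f g x. f x - g x"
  using schwartz_Rpos_set_lincomb[where a = 1 and b = "-1"] by simp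

lift_definition uminus_schwartz_Rpos :: "schwartz_Rpos \<Rightarrow> schwartz_Rpos"
  is "\<lambda>f x. - f x"
  using schwartz_Rpos_set_lincomb[where a = "-1" and b = 0] by simp

lift_definition scaleR_schwartz_Rpos :: "real \<Rightarrow> schwartz_Rpos \<Rightarrow> schwartz_Rpos"
  is "\<lambda>c f x. c * f x"
  using schwartz_Rpos_set_lincomb[where b = 0] by simp

instance
  by standard (transfer; simp add: algebra_simps)+

end

definition schwartz_seminorm :: "int \<Rightarrow> nat \<Rightarrow> schwartz_Rpos \<Rightarrow> real" where
  "schwartz_seminorm \<alpha> \<beta> f = (SUP x\<in>{0<..}. \<bar>x powi \<alpha> * (deriv ^^ \<beta>) (schwartz_fun f) x\<bar>)"

(* The subbasis consists of the seminorm balls around all points, so that it is translation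
   invariant and its finite intersections form a basis of the usual locally convex topology. *)
definition seminorm_topology :: "('i \<Rightarrow> 'a::real_vector \<Rightarrow> real) \<Rightarrow> 'a topology" where
  "seminorm_topology p = topology_generated_by {{g. p i (g - f) < r} | i f r. r > 0}"

definition schwartz_topology :: "schwartz_Rpos topology" where
  "schwartz_topology = seminorm_topology (\<lambda>(\<alpha>, \<beta>). schwartz_seminorm \<alpha> \<beta>)"

definition is_norm :: "('a::real_vector \<Rightarrow> real) \<Rightarrow> bool" where
  "is_norm N \<longleftrightarrow> (\<forall>f. 0 \<le> N f) \<and> (\<forall>f. N f = 0 \<longleftrightarrow> f = 0) \<and>
     (\<forall>c f. N (c *\<^sub>R f) = \<bar>c\<bar> * N f) \<and> (\<forall>f g. N (f + g) \<le> N f + N g)"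

definition norm_topology :: "('a::real_vector \<Rightarrow> real) \<Rightarrow> 'a topology" where
  "norm_topology N = Metric_space.mtopology UNIV (\<lambda>f g. N (f - g))"

(* Metric_space.mtopology is only meaningful for a metric. *)
lemma is_norm_Metric_space:
  assumes "is_norm N"
  shows "Metric_space UNIV (\<lambda>f g. N (f - g))"
proof
  fix f g h :: 'a
  note N = assms[unfolded is_norm_def]
  show "0 \<le> N (f - g)" using N by blast
  have "N ((-1) *\<^sub>R (f - g)) = \<bar>-1\<bar> * N (f - g)" using N by blast
  then show "N (f - g) = N (g - f)" by simp
  show "N (f - g) = 0 \<longleftrightarrow> f = g" using N by simp
  have "N ((f - g) + (g - h)) \<le> N (f - g) + N (g - h)" using N by blast
  then show "N (f - h) \<le> N (f - g) + N (g - h)" by simp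
qed

definition normable :: "'a::real_vector topology \<Rightarrow> bool" where
  "normable T \<longleftrightarrow> (\<exists>N. is_norm N \<and> norm_topology N = T)"

end

theory Submission imports Defs begin

text \<open>
  If a norm \<open>N\<close> induced the topology, its unit ball would contain a neighbourhood of \<open>0\<close> cut out
  by finitely many of the seminorms, so \<open>N\<close> would be bounded by a multiple of their sum; since
  every seminorm ball is conversely a neighbourhood of \<open>0\<close> for \<open>N\<close>, that single finite sum would
  dominate all the seminorms (\<open>normable_seminorm_topology_dominated\<close>).

  Dilations refute this. Replacing \<open>f(x)\<close> by \<open>f(c x)\<close> multiplies \<open>p\<^bsub>\<alpha>,\<beta>\<^esub>\<close> by \<open>c\<close> to the power
  \<open>\<beta> - \<alpha>\<close>, so on the dilates of one function with \<open>f(1) \<noteq> 0\<close> a finite sum of seminorms grows, as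
  \<open>c\<close> tends to \<open>0\<close>, no faster than a fixed power \<open>c\<^sup>-\<^sup>M\<close>, while \<open>p\<^bsub>M+1,0\<^esub>\<close> grows like
  \<open>c\<^sup>-\<^sup>M\<^sup>-\<^sup>1\<close>. As function one can take \<open>exp(- x - 1/x)\<close>: its derivatives are
  polynomials in \<open>1/x\<close> times the function itself, which beats every power of \<open>x\<close> at both ends of
  the half-line.
\<close>

section \<open>Normable seminorm topologies\<close>

definition is_seminorm :: "('a::real_vector \<Rightarrow> real) \<Rightarrow> bool" where
  "is_seminorm p \<longleftrightarrow> (\<forall>c f. p (c *\<^sub>R f) = \<bar>c\<bar> * p f) \<and> (\<forall>f g. p (f + g) \<le> p f + p g)"

lemma is_seminorm_scaleR: "is_seminorm p \<Longrightarrow> p (c *\<^sub>R f) = \<bar>c\<bar> * p f"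
  by (simp add: is_seminorm_def)

lemma is_seminorm_triangle: "is_seminorm p \<Longrightarrow> p (f + g) \<le> p f + p g"
  by (simp add: is_seminorm_def)

lemma is_seminorm_zero: "is_seminorm p \<Longrightarrow> p 0 = 0"
  using is_seminorm_scaleR[of p 0 0] by simp

lemma is_seminorm_nonneg:
  assumes "is_seminorm p"
  shows "0 \<le> p f"
proof -
  have "p (- f) = p f"
    using is_seminorm_scaleR[OF assms, of "-1" f] by simp
  then show ?thesis
    using is_seminorm_triangle[OF assms, of f "- f"] is_seminorm_zero[OF assms] by simp
qed

lemma is_seminorm_sum:
  assumes "\<And>i. i \<in> F \<Longrightarrow> is_seminorm (p i)"
  shows "is_seminorm (\<lambda>f. \<Sum>i\<in>F. p i f)"
  unfolding is_seminorm_def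
proof (intro conjI allI)
  show "(\<Sum>i\<in>F. p i (c *\<^sub>R f)) = \<bar>c\<bar> * (\<Sum>i\<in>F. p i f)" for c f
    by (simp add: assms is_seminorm_scaleR sum_distrib_left)
  show "(\<Sum>i\<in>F. p i (f + g)) \<le> (\<Sum>i\<in>F. p i f) + (\<Sum>i\<in>F. p i g)" for f g
    unfolding sum.distrib[symmetric] using assms by (intro sum_mono is_seminorm_triangle)
qed

lemma is_norm_is_seminorm: "is_norm N \<Longrightarrow> is_seminorm N"
  by (simp add: is_norm_def is_seminorm_def)

text \<open>
  Homogeneity turns an inclusion of balls into an inequality: scaling \<open>f\<close> so that \<open>p f\<close> is just
  below \<open>\<epsilon>\<close> (or, when \<open>p f = 0\<close>, by arbitrarily large factors) bounds \<open>q f\<close>.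
\<close>

lemma seminorm_le_of_ball_subset:
  assumes p: "is_seminorm p" and q: "is_seminorm q" and "0 < \<epsilon>"
    and ball: "\<And>g. p g < \<epsilon> \<Longrightarrow> q g < 1"
  shows "q f \<le> p f / \<epsilon>"
proof (rule field_le_epsilon)
  fix e :: real
  assume "0 < e"
  define c where "c = \<epsilon> / (p f + e * \<epsilon>)"
  have pos: "0 < p f + e * \<epsilon>"
    using is_seminorm_nonneg[OF p, of f] \<open>0 < e\<close> \<open>0 < \<epsilon>\<close> by (simp add: add_nonneg_pos)
  then have c: "0 < c"
    using \<open>0 < \<epsilon>\<close> by (simp add: c_def)
  have "p (c *\<^sub>R f) < \<epsilon>"
    using c pos \<open>0 < e\<close> \<open>0 < \<epsilon>\<close> by (simp add: is_seminorm_scaleR[OF p] c_def field_simps)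
  then have "c * q f < 1"
    using ball[of "c *\<^sub>R f"] c by (simp add: is_seminorm_scaleR[OF q])
  then show "q f \<le> p f / \<epsilon> + e"
    using pos \<open>0 < \<epsilon>\<close> by (simp add: c_def field_simps)
qed

lemma openin_seminorm_topology_ball:
  assumes "0 < r"
  shows "openin (seminorm_topology p) {g. p i (g - f) < r}"
  using assms unfolding seminorm_topology_def
  by (intro topology_generated_by_Basis) blast

text \<open>
  The subbasic balls are centred anywhere; by the triangle inequality, a ball around \<open>h\<close> that
  contains \<open>f\<close> also contains a smaller ball around \<open>f\<close>.
\<close>

lemma openin_seminorm_topologyD:
  assumes p: "\<And>i. is_seminorm (p i)"
    and U: "openin (seminorm_topology p) U" and "f \<in> U"
  obtains F \<epsilon> where "finite F" "0 < \<epsilon>" "\<And>g. \<forall>i\<in>F. p i (g - f) < \<epsilon> \<Longrightarrow> g \<in> U"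
proof -
  define B where "B = {{g. p i (g - h) < r} | i h r. r > 0}"
  have "generate_topology_on B U"
    using U by (simp add: seminorm_topology_def B_def openin_topology_generated_by_iff)
  then have "\<exists>F \<epsilon>. finite F \<and> 0 < \<epsilon> \<and> (\<forall>g. (\<forall>i\<in>F. p i (g - f) < \<epsilon>) \<longrightarrow> g \<in> U)"
    using \<open>f \<in> U\<close>
  proof (induction rule: generate_topology_on.induct)
    case Empty
    then show ?case by simp
  next
    case (Int U V)
    obtain F \<epsilon> where F: "finite F" "0 < \<epsilon>" "\<forall>g. (\<forall>i\<in>F. p i (g - f) < \<epsilon>) \<longrightarrow> g \<in> U"
      using Int by blast
    obtain G \<delta> where G: "finite G" "0 < \<delta>" "\<forall>g. (\<forall>i\<in>G. p i (g - f) < \<delta>) \<longrightarrow> g \<in> V"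
      using Int by blast
    show ?case
      using F G by (intro exI[of _ "F \<union> G"] exI[of _ "min \<epsilon> \<delta>"]) auto
  next
    case (UN K)
    then obtain V where V: "V \<in> K" "f \<in> V" by blast
    then obtain F \<epsilon> where "finite F" "0 < \<epsilon>" "\<forall>g. (\<forall>i\<in>F. p i (g - f) < \<epsilon>) \<longrightarrow> g \<in> V"
      using UN.IH by blast
    then show ?case
      using V by blast
  next
    case (Basis V)
    then obtain i h r where V: "V = {g. p i (g - h) < r}"
      by (auto simp: B_def)
    have "p i (g - h) < r" if "p i (g - f) < r - p i (f - h)" for g
      using is_seminorm_triangle[OF p, of i "g - f" "f - h"] that by simp
    then show ?case
      using Basis V by (intro exI[of _ "{i}"] exI[of _ "r - p i (f - h)"]) auto
  qed
  then show ?thesis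
    using that by blast
qed

lemma normable_seminorm_topology_dominated:
  assumes p: "\<And>i. is_seminorm (p i)" and "normable (seminorm_topology p)"
  obtains F where "finite F" "\<And>j. \<exists>C\<ge>0. \<forall>f. p j f \<le> C * (\<Sum>i\<in>F. p i f)"
proof -
  obtain N where N: "is_norm N" and eq: "norm_topology N = seminorm_topology p"
    using assms(2) by (auto simp: normable_def)
  interpret M: Metric_space UNIV "\<lambda>f g. N (f - g)"
    using N by (rule is_norm_Metric_space)
  have sN: "is_seminorm N"
    using N by (rule is_norm_is_seminorm)
  have N_minus: "N (- f) = N f" for f
    using is_seminorm_scaleR[OF sN, of "-1" f] by simp
  have "openin (seminorm_topology p) (M.mball 0 1)"
    using M.openin_mball[of 0 1] by (simp add: norm_topology_def flip: eq)
  moreover have "0 \<in> M.mball 0 1"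
    using is_seminorm_zero[OF sN] by simp
  ultimately obtain F \<epsilon> where F: "finite F" "0 < \<epsilon>"
    and sub: "\<And>g. \<forall>i\<in>F. p i (g - 0) < \<epsilon> \<Longrightarrow> g \<in> M.mball 0 1"
    using openin_seminorm_topologyD[where p = p, OF p] by blast
  define s where "s = (\<lambda>f. \<Sum>i\<in>F. p i f)"
  have s: "is_seminorm s"
    unfolding s_def by (intro is_seminorm_sum p)
  have "N g < 1" if "s g < \<epsilon>" for g
  proof -
    have "p i g \<le> s g" if "i \<in> F" for i
      unfolding s_def using that F(1) is_seminorm_nonneg[OF p] by (intro member_le_sum) auto
    then have "g \<in> M.mball 0 1"
      using sub[of g] \<open>s g < \<epsilon>\<close> by (metis diff_zero order_le_less_trans)
    then show ?thesis
      by (simp add: N_minus)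
  qed
  then have N_le: "N f \<le> s f / \<epsilon>" for f
    by (rule seminorm_le_of_ball_subset[OF s sN F(2)])
  have "\<exists>C\<ge>0. \<forall>f. p j f \<le> C * s f" for j
  proof -
    have "openin M.mtopology {g. p j (g - 0) < 1}"
      using openin_seminorm_topology_ball[of 1 p j 0] by (simp add: norm_topology_def flip: eq)
    moreover have "0 \<in> {g. p j (g - 0) < 1}"
      using is_seminorm_zero[OF p] by simp
    ultimately obtain r where r: "0 < r" "M.mball 0 r \<subseteq> {g. p j (g - 0) < 1}"
      unfolding M.openin_mtopology by blast
    then have "p j g < 1" if "N g < r" for g
      using that by (auto simp: N_minus)
    then have "p j f \<le> N f / r" for f
      by (rule seminorm_le_of_ball_subset[OF sN p r(1)])
    then have "p j f \<le> 1 / (\<epsilon> * r) * s f" for f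
      using divide_right_mono[OF N_le[of f], of r] r(1) by (force intro: order_trans)
    then show ?thesis
      using r(1) F(2) by (intro exI[of _ "1 / (\<epsilon> * r)"]) auto
  qed
  then show ?thesis
    using that F(1) unfolding s_def by blast
qed

section \<open>The seminorms of the space of rapidly decreasing functions\<close>

lemma schwartz_fun_props:
  "smooth_on_Rpos (schwartz_fun f)"
  "bdd_above ((\<lambda>x. \<bar>x powi \<alpha> * (deriv ^^ \<beta>) (schwartz_fun f) x\<bar>) ` {0<..})"
  using schwartz_fun[of f] by (auto simp: schwartz_Rpos_set_def)

lemma schwartz_seminorm_upper:
  "0 < x \<Longrightarrow> \<bar>x powi \<alpha> * (deriv ^^ \<beta>) (schwartz_fun f) x\<bar> \<le> schwartz_seminorm \<alpha> \<beta> f"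
  unfolding schwartz_seminorm_def
  by (rule cSUP_upper[OF _ schwartz_fun_props(2)]) simp

lemma schwartz_seminorm_least:
  assumes "\<And>x. 0 < x \<Longrightarrow> \<bar>x powi \<alpha> * (deriv ^^ \<beta>) (schwartz_fun f) x\<bar> \<le> B"
  shows "schwartz_seminorm \<alpha> \<beta> f \<le> B"
  unfolding schwartz_seminorm_def using assms by (intro cSUP_least) auto

lemma is_seminorm_schwartz_seminorm: "is_seminorm (schwartz_seminorm \<alpha> \<beta>)"
proof -
  let ?p = "schwartz_seminorm \<alpha> \<beta>"
  have deriv_scaleR: "(deriv ^^ \<beta>) (schwartz_fun (c *\<^sub>R f)) x = c * (deriv ^^ \<beta>) (schwartz_fun f) x"
    if "0 < x" for c f x
    using higher_deriv_lincomb_Rpos[OF schwartz_fun_props(1)[of f] schwartz_fun_props(1)[of f] that,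
        of \<beta> c 0]
    by (simp add: scaleR_schwartz_Rpos.rep_eq)
  have scaleR_le: "?p (c *\<^sub>R f) \<le> \<bar>c\<bar> * ?p f" for c f
  proof (rule schwartz_seminorm_least)
    fix x :: real
    assume "0 < x"
    then show "\<bar>x powi \<alpha> * (deriv ^^ \<beta>) (schwartz_fun (c *\<^sub>R f)) x\<bar> \<le> \<bar>c\<bar> * ?p f"
      using mult_left_mono[OF schwartz_seminorm_upper[of x \<alpha> \<beta> f], of "\<bar>c\<bar>"]
      by (simp add: deriv_scaleR abs_mult mult_ac)
  qed
  have nonneg: "0 \<le> ?p f" for f
    using schwartz_seminorm_upper[of 1 \<alpha> \<beta> f] by simp
  have "?p (c *\<^sub>R f) = \<bar>c\<bar> * ?p f" for c f
  proof (cases "c = 0")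
    case True
    then show ?thesis
      using scaleR_le[of c f] nonneg[of "c *\<^sub>R f"] by simp
  next
    case False
    then have "\<bar>c\<bar> * ?p f \<le> ?p (c *\<^sub>R f)"
      using scaleR_le[of "inverse c" "c *\<^sub>R f"] by (simp add: field_simps)
    then show ?thesis
      using scaleR_le[of c f] by simp
  qed
  moreover have "?p (f + g) \<le> ?p f + ?p g" for f g
  proof (rule schwartz_seminorm_least)
    fix x :: real
    assume x: "0 < x"
    have "(deriv ^^ \<beta>) (schwartz_fun (f + g)) x
        = (deriv ^^ \<beta>) (schwartz_fun f) x + (deriv ^^ \<beta>) (schwartz_fun g) x"
      using higher_deriv_lincomb_Rpos[OF schwartz_fun_props(1)[of f] schwartz_fun_props(1)[of g] x,
          of \<beta> 1 1]
      by (simp add: plus_schwartz_Rpos.rep_eq)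
    then show "\<bar>x powi \<alpha> * (deriv ^^ \<beta>) (schwartz_fun (f + g)) x\<bar> \<le> ?p f + ?p g"
      using schwartz_seminorm_upper[OF x, of \<alpha> \<beta> f] schwartz_seminorm_upper[OF x, of \<alpha> \<beta> g]
      by (simp add: distrib_left)
  qed
  ultimately show ?thesis
    by (simp add: is_seminorm_def)
qed

section \<open>Dilations\<close>

lemma has_derivative_higher_deriv_dilation:
  assumes f: "smooth_on_Rpos f" and c: "0 < c" and x: "0 < x"
  shows "((\<lambda>x. c ^ n * (deriv ^^ n) f (c * x)) has_field_derivative
    c ^ Suc n * (deriv ^^ Suc n) f (c * x)) (at x)"
proof -
  have "((deriv ^^ n) f has_field_derivative (deriv ^^ Suc n) f (c * x)) (at (c * x))"
    using f c x by (simp add: smooth_on_Rpos_def field_differentiable_derivI)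
  then have "((\<lambda>x. (deriv ^^ n) f (c * x)) has_field_derivative
      (deriv ^^ Suc n) f (c * x) * c) (at x)"
    by (rule DERIV_chain2) (auto intro!: derivative_eq_intros)
  then have "((\<lambda>x. c ^ n * (deriv ^^ n) f (c * x)) has_field_derivative
      c ^ n * ((deriv ^^ Suc n) f (c * x) * c)) (at x)"
    by (rule DERIV_cmult)
  then show ?thesis
    by (simp add: mult_ac)
qed

text \<open>
  A sequence of functions in which each is the derivative of its predecessor on the half-line
  consists of the iterated derivatives of its first member. This replaces computing with nested
  \<open>deriv\<close> by exhibiting a closed form for all orders at once.
\<close>

lemma higher_deriv_Rpos_eqI:
  fixes D :: "nat \<Rightarrow> real \<Rightarrow> real"
  assumes D: "\<And>n x. 0 < x \<Longrightarrow> (D n has_field_derivative D (Suc n) x) (at x)"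
    and f: "\<And>x. 0 < x \<Longrightarrow> f x = D 0 x" and "0 < x"
  shows "(deriv ^^ n) f x = D n x" "(deriv ^^ n) f field_differentiable at x"
proof -
  have eq: "\<forall>x>0. (deriv ^^ n) f x = D n x" for n
  proof (induction n)
    case 0
    then show ?case using f by simp
  next
    case (Suc n)
    have "((deriv ^^ n) f has_field_derivative D (Suc n) x) (at x)" if "0 < x" for x
      using D[OF that, of n]
      by (rule has_field_derivative_transform_within_open[where S = "{0<..}"])
        (use that Suc in auto)
    then show ?case
      by (simp add: DERIV_imp_deriv)
  qed
  show "(deriv ^^ n) f x = D n x"
    using eq \<open>0 < x\<close> by blast
  have "((deriv ^^ n) f has_field_derivative D (Suc n) x) (at x)"
    using D[OF \<open>0 < x\<close>, of n]
    by (rule has_field_derivative_transform_within_open[where S = "{0<..}"])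
      (use \<open>0 < x\<close> eq in auto)
  then show "(deriv ^^ n) f field_differentiable at x"
    by (auto simp: field_differentiable_def)
qed

lemma schwartz_dilation:
  fixes f :: schwartz_Rpos
  assumes c: "0 < c"
  obtains g where "\<And>x. schwartz_fun g x = schwartz_fun f (c * x)"
    and "\<And>\<alpha> \<beta>. schwartz_seminorm \<alpha> \<beta> g \<le> c powi (int \<beta> - \<alpha>) * schwartz_seminorm \<alpha> \<beta> f"
proof -
  define h where "h = (\<lambda>x. schwartz_fun f (c * x))"
  have D: "(deriv ^^ n) h x = c ^ n * (deriv ^^ n) (schwartz_fun f) (c * x)"
    and diff: "(deriv ^^ n) h field_differentiable at x" if "0 < x" for n x
    using higher_deriv_Rpos_eqI[where D = "\<lambda>n x. c ^ n * (deriv ^^ n) (schwartz_fun f) (c * x)"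
        and f = h, OF has_derivative_higher_deriv_dilation[OF schwartz_fun_props(1) c] _ that]
    by (simp_all add: h_def)
  have bound: "\<bar>x powi \<alpha> * (deriv ^^ \<beta>) h x\<bar> \<le> c powi (int \<beta> - \<alpha>) * schwartz_seminorm \<alpha> \<beta> f"
    if "0 < x" for x \<alpha> \<beta>
  proof -
    have "x powi \<alpha> * (deriv ^^ \<beta>) h x
        = c powi (int \<beta> - \<alpha>) * ((c * x) powi \<alpha> * (deriv ^^ \<beta>) (schwartz_fun f) (c * x))"
      using c that by (simp add: D power_int_diff power_int_mult_distrib)
    then show ?thesis
      using schwartz_seminorm_upper[of "c * x" \<alpha> \<beta> f] c that
      by (simp add: abs_mult mult_left_mono)
  qed
  have "h \<in> schwartz_Rpos_set"
    unfolding schwartz_Rpos_set_def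
  proof (intro CollectI conjI allI impI)
    show "h x = 0" if "x \<le> 0" for x
      using schwartz_fun[of f] c that by (simp add: h_def schwartz_Rpos_set_def mult_nonneg_nonpos)
    show "smooth_on_Rpos h"
      using diff by (simp add: smooth_on_Rpos_def)
    show "bdd_above ((\<lambda>x. \<bar>x powi \<alpha> * (deriv ^^ \<beta>) h x\<bar>) ` {0<..})" for \<alpha> \<beta>
      using bound by (intro bdd_aboveI2) auto
  qed
  then have "schwartz_fun (Abs_schwartz_Rpos h) = h"
    by (rule Abs_schwartz_Rpos_inverse)
  then show ?thesis
    using that[of "Abs_schwartz_Rpos h"] schwartz_seminorm_least[of _ _ "Abs_schwartz_Rpos h"] bound
    by (simp add: h_def)
qed

section \<open>A nonzero rapidly decreasing function\<close>

text \<open>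
  The term \<open>y\<^sup>k / k!\<close> of the exponential series bounds positive powers of \<open>x\<close> by \<open>exp x\<close> and negative
  ones by \<open>exp (1/x)\<close>; the weight \<open>exp(- x - 1/x)\<close> absorbs both.
\<close>

lemma powi_mult_exp_le_fact:
  fixes x :: real
  assumes "0 < x"
  shows "x powi m * exp (- x - 1 / x) \<le> fact (nat \<bar>m\<bar>)"
proof -
  define k where "k = nat \<bar>m\<bar>"
  have pow_le: "y ^ k \<le> fact k * exp y" if "0 \<le> y" for y :: real
    using sum_le_suminf[OF summable_exp, of "{k}" y] that by (simp add: exp_def field_simps)
  have "x powi m \<le> fact k * exp (x + 1 / x)"
  proof (cases "0 \<le> m")
    case True
    then have "x powi m = x ^ k"
      by (simp add: k_def power_int_def)
    also have "\<dots> \<le> fact k * exp x"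
      using assms by (intro pow_le) simp
    also have "\<dots> \<le> fact k * exp (x + 1 / x)"
      using assms by simp
    finally show ?thesis .
  next
    case False
    then have "x powi m = (1 / x) ^ k"
      by (simp add: k_def power_int_def field_simps)
    also have "\<dots> \<le> fact k * exp (1 / x)"
      using assms by (intro pow_le) simp
    also have "\<dots> \<le> fact k * exp (x + 1 / x)"
      using assms by simp
    finally show ?thesis .
  qed
  then show ?thesis
    by (simp add: k_def[symmetric] exp_diff exp_minus exp_add field_simps)
qed


text \<open>
  The polynomials \<open>P\<^sub>n\<close> for which \<open>P\<^sub>n(1/x) exp(- x - 1/x)\<close> is the \<open>n\<close>-th derivative of
  \<open>exp(- x - 1/x)\<close>.
\<close>

primrec exp_deriv_poly :: "nat \<Rightarrow> real poly" where
  "exp_deriv_poly 0 = 1"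
| "exp_deriv_poly (Suc n) =
    [:-1, 0, 1:] * exp_deriv_poly n - [:0, 0, 1:] * pderiv (exp_deriv_poly n)"

lemma has_derivative_exp_deriv_poly:
  fixes x :: real
  assumes "0 < x"
  shows "((\<lambda>x. poly (exp_deriv_poly n) (1 / x) * exp (- x - 1 / x)) has_field_derivative
    poly (exp_deriv_poly (Suc n)) (1 / x) * exp (- x - 1 / x)) (at x)"
proof -
  have "((\<lambda>x. 1 / x) has_field_derivative - (1 / x\<^sup>2)) (at x)"
    using assms by (auto intro!: derivative_eq_intros simp: power2_eq_square)
  from DERIV_chain2[OF poly_DERIV this]
  have "((\<lambda>x. poly (exp_deriv_poly n) (1 / x)) has_field_derivative
      poly (pderiv (exp_deriv_poly n)) (1 / x) * - (1 / x\<^sup>2)) (at x)" .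
  moreover have "((\<lambda>x. exp (- x - 1 / x)) has_field_derivative
      exp (- x - 1 / x) * (1 / x\<^sup>2 - 1)) (at x)"
    using assms by (auto intro!: derivative_eq_intros simp: power2_eq_square)
  ultimately show ?thesis
    by (rule DERIV_mult[THEN DERIV_cong]) (simp add: power2_eq_square algebra_simps)
qed

lemma poly_exp_rapidly_decreasing:
  fixes x :: real and P :: "real poly"
  assumes x: "0 < x"
  shows "\<bar>x powi \<alpha> * (poly P (1 / x) * exp (- x - 1 / x))\<bar>
    \<le> (\<Sum>i\<le>degree P. \<bar>coeff P i\<bar> * fact (nat \<bar>\<alpha> - int i\<bar>))"
proof -
  have "x powi \<alpha> * (poly P (1 / x) * exp (- x - 1 / x))
      = (\<Sum>i\<le>degree P. coeff P i * (x powi (\<alpha> - int i) * exp (- x - 1 / x)))"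
    using x
    by (simp add: poly_altdef sum_distrib_left sum_distrib_right power_int_diff power_divide mult_ac)
  also have "\<bar>\<dots>\<bar> \<le> (\<Sum>i\<le>degree P. \<bar>coeff P i * (x powi (\<alpha> - int i) * exp (- x - 1 / x))\<bar>)"
    by (rule sum_abs)
  also have "\<dots> \<le> (\<Sum>i\<le>degree P. \<bar>coeff P i\<bar> * fact (nat \<bar>\<alpha> - int i\<bar>))"
    using x powi_mult_exp_le_fact[OF x]
    by (intro sum_mono) (simp add: abs_mult mult_left_mono)
  finally show ?thesis .
qed

lemma schwartz_fun_nonzero_at_1: obtains f where "schwartz_fun f 1 \<noteq> 0"
proof -
  define h :: "real \<Rightarrow> real" where "h = (\<lambda>x. if x \<le> 0 then 0 else exp (- x - 1 / x))"
  have D: "(deriv ^^ n) h x = poly (exp_deriv_poly n) (1 / x) * exp (- x - 1 / x)"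
    and diff: "(deriv ^^ n) h field_differentiable at x" if "0 < x" for n x
    using higher_deriv_Rpos_eqI[where f = h
        and D = "\<lambda>n x. poly (exp_deriv_poly n) (1 / x) * exp (- x - 1 / x)",
        OF has_derivative_exp_deriv_poly _ that]
    by (simp_all add: h_def)
  have "h \<in> schwartz_Rpos_set"
    unfolding schwartz_Rpos_set_def
  proof (intro CollectI conjI allI impI)
    show "h x = 0" if "x \<le> 0" for x
      using that by (simp add: h_def)
    show "smooth_on_Rpos h"
      using diff by (simp add: smooth_on_Rpos_def)
    show "bdd_above ((\<lambda>x. \<bar>x powi \<alpha> * (deriv ^^ \<beta>) h x\<bar>) ` {0<..})" for \<alpha> \<beta>
      using D poly_exp_rapidly_decreasing by (intro bdd_aboveI2) auto
  qed
  then have "schwartz_fun (Abs_schwartz_Rpos h) 1 \<noteq> 0"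
    by (simp add: Abs_schwartz_Rpos_inverse h_def)
  then show ?thesis
    by (rule that)
qed

section \<open>Non-normability\<close>

text \<open>
  It is enough that \<open>\<alpha>\<close> exceeds all the differences \<open>\<alpha>' - \<beta>'\<close> that occur in the finite sum:
  dilating a fixed function by a small \<open>c\<close> then makes the sum negligible against \<open>p\<^bsub>\<alpha>,0\<^esub>\<close>.
\<close>

lemma schwartz_seminorms_not_dominated:
  assumes F: "finite F"
  obtains \<alpha> where "\<And>C. 0 \<le> C \<Longrightarrow>
    \<exists>f. C * (\<Sum>(\<alpha>', \<beta>')\<in>F. schwartz_seminorm \<alpha>' \<beta>' f) < schwartz_seminorm \<alpha> 0 f"
proof -
  obtain f where f: "schwartz_fun f 1 \<noteq> 0"
    using schwartz_fun_nonzero_at_1 .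
  obtain M where M: "\<And>\<alpha> \<beta>. (\<alpha>, \<beta>) \<in> F \<Longrightarrow> \<alpha> - int \<beta> \<le> M"
    using bdd_above_finite[OF finite_imageI[OF F, of "\<lambda>(\<alpha>, \<beta>). \<alpha> - int \<beta>"]]
    by (fastforce simp: bdd_above_def)
  define S where "S = (\<lambda>f. \<Sum>(\<alpha>, \<beta>)\<in>F. schwartz_seminorm \<alpha> \<beta> f)"
  have S_nonneg: "0 \<le> S f"
    unfolding S_def using is_seminorm_nonneg[OF is_seminorm_schwartz_seminorm]
    by (intro sum_nonneg) auto
  have "\<exists>g. C * S g < schwartz_seminorm (M + 1) 0 g" if "0 \<le> C" for C
  proof -
    \<comment> \<open>small enough for \<open>C\<close> times the sum for \<open>f\<close> to stay below \<open>\<bar>f(1)\<bar> / c\<close>; at most \<open>1\<close>, so that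
      \<open>c\<^sup>-\<^sup>M\<close> dominates all the powers of \<open>c\<close> that occur\<close>
    define c where "c = min 1 (\<bar>schwartz_fun f 1\<bar> / (C * S f + 1))"
    have pos: "0 < C * S f + 1"
      using S_nonneg that by (simp add: add_nonneg_pos)
    moreover have "c \<le> \<bar>schwartz_fun f 1\<bar> / (C * S f + 1)"
      by (simp add: c_def)
    moreover have "0 < c" "c \<le> 1"
      using f pos by (simp_all add: c_def)
    ultimately have c: "0 < c" "c \<le> 1" "c * (C * S f + 1) \<le> \<bar>schwartz_fun f 1\<bar>"
      using pos by (simp_all add: pos_le_divide_eq)
    obtain g where g: "\<And>x. schwartz_fun g x = schwartz_fun f (c * x)"
      and g_le: "\<And>\<alpha> \<beta>. schwartz_seminorm \<alpha> \<beta> g \<le> c powi (int \<beta> - \<alpha>) * schwartz_seminorm \<alpha> \<beta> f"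
      using schwartz_dilation[OF c(1)] by metis
    have "S g \<le> c powi (- M) * S f"
      unfolding S_def sum_distrib_left
    proof (intro sum_mono, clarify)
      fix \<alpha> \<beta>
      assume "(\<alpha>, \<beta>) \<in> F"
      then have "c powi (int \<beta> - \<alpha>) \<le> c powi (- M)"
        using c M by (intro power_int_decreasing) fastforce+
      then show "schwartz_seminorm \<alpha> \<beta> g \<le> c powi (- M) * schwartz_seminorm \<alpha> \<beta> f"
        using g_le[of \<alpha> \<beta>] is_seminorm_nonneg[OF is_seminorm_schwartz_seminorm, of \<alpha> \<beta> f]
        by (meson mult_right_mono order_trans)
    qed
    then have "C * S g \<le> c powi (- M) * (C * S f)"
      using mult_left_mono[OF _ \<open>0 \<le> C\<close>] by (fastforce simp: mult_ac)
    also have "\<dots> < c powi (- M) * (\<bar>schwartz_fun f 1\<bar> / c)"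
      using c by (intro mult_strict_left_mono) (simp_all add: field_simps)
    also have "\<dots> = c powi (- (M + 1)) * \<bar>schwartz_fun f 1\<bar>"
      using c(1) by (simp add: power_int_diff[of c "- M" 1, simplified])
    \<comment> \<open>the dilate takes the value \<open>f(1)\<close> at \<open>1/c\<close>\<close>
    also have "\<dots> = \<bar>(1 / c) powi (M + 1) * (deriv ^^ 0) (schwartz_fun g) (1 / c)\<bar>"
    proof -
      have "(1 / c) powi (M + 1) = c powi (- (M + 1))"
        by (simp only: power_int_one_over power_int_minus inverse_eq_divide)
      moreover have "0 < c powi (- (M + 1))"
        using c(1) by (rule zero_less_power_int)
      ultimately show ?thesis
        using c(1) by (simp only: abs_mult) (simp add: g)
    qed
    also have "\<dots> \<le> schwartz_seminorm (M + 1) 0 g"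
      using c(1) by (intro schwartz_seminorm_upper) simp
    finally show ?thesis
      by blast
  qed
  then show ?thesis
    using that unfolding S_def by blast
qed

theorem theorem5: "\<not> normable schwartz_topology"
proof
  assume "normable schwartz_topology"
  then obtain F where F: "finite F" and dominated: "\<And>j. \<exists>C\<ge>0. \<forall>f.
      (case j of (\<alpha>, \<beta>) \<Rightarrow> schwartz_seminorm \<alpha> \<beta>) f
        \<le> C * (\<Sum>i\<in>F. (case i of (\<alpha>, \<beta>) \<Rightarrow> schwartz_seminorm \<alpha> \<beta>) f)"
    unfolding schwartz_topology_def
    by (rule normable_seminorm_topology_dominated[rotated])
      (auto intro: is_seminorm_schwartz_seminorm)
  obtain \<alpha> where \<alpha>: "\<And>C. 0 \<le> C \<Longrightarrow>
      \<exists>f. C * (\<Sum>(\<alpha>', \<beta>')\<in>F. schwartz_seminorm \<alpha>' \<beta>' f) < schwartz_seminorm \<alpha> 0 f"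
    using schwartz_seminorms_not_dominated[OF F] by blast
  obtain C where "0 \<le> C" and C: "\<And>f. schwartz_seminorm \<alpha> 0 f
      \<le> C * (\<Sum>(\<alpha>', \<beta>')\<in>F. schwartz_seminorm \<alpha>' \<beta>' f)"
    using dominated[of "(\<alpha>, 0)"] by (auto simp: case_prod_unfold)
  then show False
    using \<alpha>[of C] by (meson not_less)
qed

end
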